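(* Let $m$ be a positive integer, let $G$ be a graph, and let $\varepsilon$ and $c$ be nonnegative real numbers with $\varepsilon\le 1 \le c$. If for every $S\subseteq V(G)$, $$\omega(G\setminus S)+\frac{m+1}{2}\, iso(G\setminus S) \le \frac{\varepsilon}{m}|S|+c,$$ then for every $S\subseteq V(G)$, $\Omega_m(G\setminus S) \le \varepsilon |S|+cm$.
   Context: Graphs are finite, loopless, and may have multiple edges. $\omega(H)$ is the number of components of $H$ and $iso(H)$ the number of isolated vertices; $G\setminus S$ is obtained by deleting $S$. A graph is $m$-tree-connected if it contains $m$ pairwise edge-disjoint spanning trees (a one-vertex graph is $m$-tree-connected). The $m$-tree-connected components of a graph are its maximal induced $m$-tree-connected subgraphs; their vertex sets partition the vertex set. For a partition $P$ of $V(H)$, $e_H(P)$ is the number of edges with ends in different parts; $\Omega_m(H)=m|P|-e_H(P)$ for $P$ the partition into vertex sets of the $m$-tree-connected components, and $\Omega_m=0$ for the graph with no vertices. *)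

theory Defs
  imports Complex_Main
begin

text \<open>
  An edge is an abstract object carrying the set of its two ends, so that distinct edges may be
  parallel.
\<close>

record ('v, 'e) mgraph =
  verts :: "'v set"
  edges :: "'e set"
  ends  :: "'e \<Rightarrow> 'v set"

locale multigraph =
  fixes G :: "('v, 'e) mgraph"
  assumes finite_verts: "finite (verts G)"
    and finite_edges: "finite (edges G)"
    and ends_wf: "\<And>e. e \<in> edges G \<Longrightarrow> ends G e \<subseteq> verts G \<and> card (ends G e) = 2"

definition induced :: "('v, 'e) mgraph \<Rightarrow> 'v set \<Rightarrow> ('v, 'e) mgraph" where
  "induced G U = G\<lparr>verts := U, edges := {e \<in> edges G. ends G e \<subseteq> U}\<rparr>"

definition del_verts :: "('v, 'e) mgraph \<Rightarrow> 'v set \<Rightarrow> ('v, 'e) mgraph" where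
  "del_verts G S = induced G (verts G - S)"

definition adj :: "('v, 'e) mgraph \<Rightarrow> ('v \<times> 'v) set" where
  "adj G = {(u, v). \<exists>e \<in> edges G. ends G e = {u, v}}"

definition reach :: "('v, 'e) mgraph \<Rightarrow> ('v \<times> 'v) set" where
  "reach G = {(u, v). u \<in> verts G \<and> v \<in> verts G \<and> (u, v) \<in> (adj G)\<^sup>*}"

definition num_components :: "('v, 'e) mgraph \<Rightarrow> nat" where
  "num_components G = card (verts G // reach G)"

definition num_isolated :: "('v, 'e) mgraph \<Rightarrow> nat" where
  "num_isolated G = card {v \<in> verts G. \<forall>e \<in> edges G. v \<notin> ends G e}"

text \<open>The graph without vertices does not count as connected, hence not as a tree.\<close>

definition connected_graph :: "('v, 'e) mgraph \<Rightarrow> bool" where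
  "connected_graph G \<longleftrightarrow>
     verts G \<noteq> {} \<and> (\<forall>u \<in> verts G. \<forall>v \<in> verts G. (u, v) \<in> reach G)"

text \<open>
  A cycle is listed as \<open>v\<^sub>0, e\<^sub>0, v\<^sub>1, e\<^sub>1, \<dots>\<close>, the edge \<open>e\<^sub>i\<close> joining \<open>v\<^sub>i\<close> to its cyclic successor;
  two parallel edges form a cycle of length 2.
\<close>

definition is_cycle :: "('v, 'e) mgraph \<Rightarrow> 'v list \<Rightarrow> 'e list \<Rightarrow> bool" where
  "is_cycle G vs es \<longleftrightarrow>
     vs \<noteq> [] \<and> length es = length vs \<and> distinct vs \<and> distinct es \<and>
     set vs \<subseteq> verts G \<and> set es \<subseteq> edges G \<and>
     (\<forall>i < length vs. ends G (es ! i) = {vs ! i, vs ! (Suc i mod length vs)})"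

definition is_tree :: "('v, 'e) mgraph \<Rightarrow> bool" where
  "is_tree G \<longleftrightarrow> connected_graph G \<and> (\<nexists>vs es. is_cycle G vs es)"

definition spanning_tree :: "('v, 'e) mgraph \<Rightarrow> 'e set \<Rightarrow> bool" where
  "spanning_tree G T \<longleftrightarrow> T \<subseteq> edges G \<and> is_tree (G\<lparr>edges := T\<rparr>)"

text \<open>
  The trees form an indexed family, and only their edge sets have to be disjoint; a one-vertex
  loopless graph therefore qualifies for every \<open>m\<close>, with \<open>T i = {}\<close> for all \<open>i\<close>.
\<close>

definition tree_connected :: "nat \<Rightarrow> ('v, 'e) mgraph \<Rightarrow> bool" where
  "tree_connected m G \<longleftrightarrow>
     (\<exists>T :: nat \<Rightarrow> 'e set. (\<forall>i < m. spanning_tree G (T i)) \<and>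
        (\<forall>i < m. \<forall>j < m. i \<noteq> j \<longrightarrow> T i \<inter> T j = {}))"

text \<open>An induced subgraph is represented by its vertex set.\<close>

definition tree_connected_components :: "nat \<Rightarrow> ('v, 'e) mgraph \<Rightarrow> 'v set set" where
  "tree_connected_components m G =
     {U. U \<subseteq> verts G \<and> tree_connected m (induced G U) \<and>
         (\<forall>W. U \<subset> W \<and> W \<subseteq> verts G \<longrightarrow> \<not> tree_connected m (induced G W))}"

definition crossing_edges :: "('v, 'e) mgraph \<Rightarrow> 'v set set \<Rightarrow> nat" where
  "crossing_edges G P =
     card {e \<in> edges G. \<exists>u v. \<exists>X \<in> P. \<exists>Y \<in> P. ends G e = {u, v} \<and> u \<in> X \<and> v \<in> Y \<and> X \<noteq> Y}"

text \<open>
  For \<open>m > 0\<close> the graph without vertices has no \<open>m\<close>-tree-connected component, so the formula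
  gives it the value 0.
\<close>

definition Omega :: "nat \<Rightarrow> ('v, 'e) mgraph \<Rightarrow> int" where
  "Omega m G = (let P = tree_connected_components m G
                in int m * int (card P) - int (crossing_edges G P))"

end

theory Submission imports Defs begin

text \<open>
  The \<open>m\<close>-tree-connectedness of the components is only needed to see that they partition the
  vertices. For an arbitrary partition \<open>P\<close> of the vertices of a graph \<open>H\<close> there is a vertex set
  \<open>X\<close> with \<open>m \<omega>(H - X) + m (m + 1) / 2 iso(H - X) \<ge> m |P| - e(P) + |X|\<close>; applying the hypothesis
  to \<open>S \<union> X\<close> and \<open>H = G - S\<close> then gives the claim, since \<open>\<epsilon> \<le> 1\<close>.
  To find \<open>X\<close>, delete vertices as long as this does not decrease \<open>m |P| - e(P) - |X|\<close>: a vertex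
  in a part of size at least two that has a crossing edge, or any vertex with at least \<open>m + 1\<close>
  crossing edges. Afterwards the parts of size at least two have no edges to the outside, and the
  other parts span a graph of maximum degree at most \<open>m\<close>. Such a graph on \<open>n\<close> vertices with \<open>e\<close>
  edges has an independent set \<open>I\<close> with \<open>(m + 1) (m + 2) / 2 |I| \<ge> (m + 1) n - e\<close> (the greedy
  bound of Caro and Wei), and one deletes all its other vertices.
\<close>

section \<open>Tree-connected components\<close>

lemma multigraph_induced:
  assumes "multigraph G" "U \<subseteq> verts G"
  shows "multigraph (induced G U)"
proof -
  interpret multigraph G by fact
  show ?thesis
    using assms(2) finite_verts finite_edges ends_wf
    by unfold_locales (auto simp: induced_def intro: finite_subset)
qed

lemma induced_induced:
  assumes "W \<subseteq> U"
  shows "induced (induced G U) W = induced G W"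
proof -
  have "{e \<in> edges G. ends G e \<subseteq> U \<and> ends G e \<subseteq> W} = {e \<in> edges G. ends G e \<subseteq> W}"
    using assms by blast
  then show ?thesis by (simp add: induced_def)
qed

lemma sym_adj: "sym (adj G)"
  by (auto simp: adj_def sym_def insert_commute)

lemma sym_adj_rtrancl: "(u, v) \<in> (adj G)\<^sup>* \<Longrightarrow> (v, u) \<in> (adj G)\<^sup>*"
  using sym_rtrancl[OF sym_adj] by (meson symD)

lemma adj_mono:
  assumes "edges G \<subseteq> edges H" "ends G = ends H"
  shows "adj G \<subseteq> adj H"
  using assms by (auto simp: adj_def)

text \<open>The rest of the cycle joins the ends of its first edge, so reachability survives without
  that edge.\<close>

lemma cycle_edge_removable:
  assumes "multigraph G" "is_cycle G vs es"
  obtains e where "e \<in> edges G" "adj G \<subseteq> (adj (G\<lparr>edges := edges G - {e}\<rparr>))\<^sup>*"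
proof -
  interpret multigraph G by fact
  define n where "n = length vs"
  define e where "e = es ! 0"
  let ?A = "adj (G\<lparr>edges := edges G - {e}\<rparr>)"
  have n0: "n > 0" and len: "length es = n" and dist: "distinct es" and es: "set es \<subseteq> edges G"
    and en: "\<And>i. i < n \<Longrightarrow> ends G (es ! i) = {vs ! i, vs ! (Suc i mod n)}"
    using assms(2) by (auto simp: is_cycle_def n_def)
  have eG: "e \<in> edges G" using es n0 len by (auto simp: e_def)
  have ends_e: "ends G e = {vs ! 0, vs ! (1 mod n)}" using en[of 0] n0 by (simp add: e_def)
  \<comment> \<open>A cycle of length 1 would be a loop, whose end set has only one element.\<close>
  have "n \<noteq> 1" using ends_wf[OF eG] ends_e by auto
  with n0 have n2: "n \<ge> 2" by simp
  have stp: "(vs ! i, vs ! (Suc i mod n)) \<in> ?A" if "0 < i" "i < n" for i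
  proof -
    have "es ! i \<noteq> e" using that dist len n0 by (simp add: e_def nth_eq_iff_index_eq)
    moreover have "es ! i \<in> edges G" using that es len by auto
    ultimately show ?thesis using en[of i] that by (auto simp: adj_def)
  qed
  have walk: "(vs ! 1, vs ! Suc k) \<in> ?A\<^sup>*" if "Suc k < n" for k
    using that
  proof (induction k)
    case (Suc k)
    have "(vs ! Suc k, vs ! Suc (Suc k)) \<in> ?A" using stp[of "Suc k"] Suc.prems by simp
    with Suc show ?case by (simp add: rtrancl.rtrancl_into_rtrancl)
  qed simp
  have "(vs ! 1, vs ! (n - 1)) \<in> ?A\<^sup>*" using walk[of "n - 2"] n2 by (simp add: numeral_2_eq_2 Suc_diff_Suc)
  moreover have "(vs ! (n - 1), vs ! 0) \<in> ?A" using stp[of "n - 1"] n2 by simp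
  ultimately have 1: "(vs ! 1, vs ! 0) \<in> ?A\<^sup>*" by simp
  have 2: "(vs ! 0, vs ! 1) \<in> ?A\<^sup>*" using 1 by (rule sym_adj_rtrancl)
  have "adj G \<subseteq> ?A\<^sup>*"
  proof
    fix x assume "x \<in> adj G"
    then obtain u v f where x: "x = (u, v)" and f: "f \<in> edges G" "ends G f = {u, v}"
      by (auto simp: adj_def)
    show "x \<in> ?A\<^sup>*"
    proof (cases "f = e")
      case True
      with f ends_e n2 have "{u, v} = {vs ! 0, vs ! 1}" by simp
      with 1 2 x show ?thesis by (auto simp: doubleton_eq_iff)
    next
      case False
      with f x show ?thesis by (auto simp: adj_def)
    qed
  qed
  with eG show thesis by (rule that)
qed

text \<open>A connected spanning subset of \<open>T\<close> with fewest edges has no cycle, since an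
  edge of a cycle could be dropped. Staying inside \<open>T\<close> lets disjoint edge sets yield
  disjoint trees.\<close>

lemma connected_has_spanning_tree:
  assumes "multigraph G" "T \<subseteq> edges G" "connected_graph (G\<lparr>edges := T\<rparr>)"
  obtains T' where "T' \<subseteq> T" "spanning_tree G T'"
proof -
  interpret multigraph G by fact
  let ?C = "\<lambda>T'. T' \<subseteq> T \<and> connected_graph (G\<lparr>edges := T'\<rparr>)"
  obtain T' where T': "?C T'" and mini: "\<And>T''. card T'' < card T' \<Longrightarrow> \<not> ?C T''"
    using assms(3) exists_least_iff[of "\<lambda>k. \<exists>T'. card T' = k \<and> ?C T'"] by blast
  have fin: "finite T'" using T' assms(2) finite_edges by (meson finite_subset)
  have mg: "multigraph (G\<lparr>edges := T'\<rparr>)"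
    using fin T' assms(2) finite_verts ends_wf by unfold_locales auto
  have "\<not> is_cycle (G\<lparr>edges := T'\<rparr>) vs es" for vs es
  proof
    assume "is_cycle (G\<lparr>edges := T'\<rparr>) vs es"
    from cycle_edge_removable[OF mg this] obtain e where e: "e \<in> T'"
      and sub: "adj (G\<lparr>edges := T'\<rparr>) \<subseteq> (adj (G\<lparr>edges := T' - {e}\<rparr>))\<^sup>*"
      by auto
    have "(adj (G\<lparr>edges := T'\<rparr>))\<^sup>* \<subseteq> (adj (G\<lparr>edges := T' - {e}\<rparr>))\<^sup>*"
      using sub by (metis rtrancl_subset_rtrancl)
    then have "?C (T' - {e})" using T' by (auto simp: connected_graph_def reach_def)
    moreover have "card (T' - {e}) < card T'" using e fin by (meson card_Diff1_less)
    ultimately show False using mini by blast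
  qed
  then have "spanning_tree G T'" using T' assms(2) by (auto simp: spanning_tree_def is_tree_def)
  with T' show thesis using that by blast
qed

text \<open>The \<open>i\<close>-th tree of \<open>U\<close>, together with the edges of the
  \<open>i\<close>-th tree of \<open>W\<close> that do not lie inside \<open>U\<close>, connects
  \<open>U \<union> W\<close>. These edge sets are pairwise disjoint and are then thinned out to
  trees.\<close>

lemma tree_connected_Un:
  assumes G: "multigraph G" and sub: "U \<subseteq> verts G" "W \<subseteq> verts G" and int: "U \<inter> W \<noteq> {}"
    and U: "tree_connected m (induced G U)" and W: "tree_connected m (induced G W)"
  shows "tree_connected m (induced G (U \<union> W))"
proof -
  interpret multigraph G by fact
  let ?K = "induced G (U \<union> W)"
  have K: "multigraph ?K" using G sub by (simp add: multigraph_induced)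
  obtain T where T: "\<And>i. i < m \<Longrightarrow> spanning_tree (induced G U) (T i)"
    and Td: "\<And>i j. i < m \<Longrightarrow> j < m \<Longrightarrow> i \<noteq> j \<Longrightarrow> T i \<inter> T j = {}"
    using U unfolding tree_connected_def by blast
  obtain R where R: "\<And>i. i < m \<Longrightarrow> spanning_tree (induced G W) (R i)"
    and Rd: "\<And>i j. i < m \<Longrightarrow> j < m \<Longrightarrow> i \<noteq> j \<Longrightarrow> R i \<inter> R j = {}"
    using W unfolding tree_connected_def by blast
  \<comment> \<open>An edge of \<open>R i\<close> inside \<open>U\<close> might belong to some
    \<open>T j\<close> with \<open>j \<noteq> i\<close>, so such edges are discarded.\<close>
  define Q where "Q i = T i \<union> {e \<in> R i. \<not> ends G e \<subseteq> U}" for i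
  obtain z where z: "z \<in> U" "z \<in> W" using int by auto
  have Qd: "Q i \<inter> Q j = {}" if "i < m" "j < m" "i \<noteq> j" for i j
    using Td[OF that] Rd[OF that] T[OF that(1)] T[OF that(2)]
    by (auto simp: Q_def spanning_tree_def induced_def)
  have "\<exists>T'. T' \<subseteq> Q i \<and> spanning_tree ?K T'" if i: "i < m" for i
  proof -
    have Qs: "Q i \<subseteq> edges ?K" using T[OF i] R[OF i]
      by (auto simp: Q_def spanning_tree_def induced_def)
    let ?A = "adj (?K\<lparr>edges := Q i\<rparr>)"
    have TA: "adj (induced G U\<lparr>edges := T i\<rparr>) \<subseteq> ?A"
      by (rule adj_mono) (auto simp: Q_def induced_def)
    have UU: "(u, z) \<in> ?A\<^sup>*" if "u \<in> U" for u
    proof -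
      have "(u, z) \<in> (adj (induced G U\<lparr>edges := T i\<rparr>))\<^sup>*"
        using T[OF i] that z
        by (simp add: spanning_tree_def is_tree_def connected_graph_def reach_def induced_def)
      then show ?thesis using rtrancl_mono[OF TA] by blast
    qed
    have WW: "(w, z) \<in> ?A\<^sup>*" if "w \<in> W" for w
    proof -
      have "(w, z) \<in> (adj (induced G W\<lparr>edges := R i\<rparr>))\<^sup>*"
        using R[OF i] that z
        by (simp add: spanning_tree_def is_tree_def connected_graph_def reach_def induced_def)
      \<comment> \<open>Follow the walk in \<open>R i\<close> towards \<open>z\<close>: as long as
        it is outside \<open>U\<close> its edges are kept in \<open>Q i\<close>; once it meets
        \<open>U\<close>, the tree \<open>T i\<close> leads to \<open>z\<close>.\<close>
      then show ?thesis
      proof (induction rule: converse_rtrancl_induct)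
        case (step x y)
        show ?case
        proof (cases "x \<in> U")
          case False
          with step(1) have "(x, y) \<in> ?A" by (auto simp: adj_def Q_def induced_def)
          with step(3) show ?thesis by (rule converse_rtrancl_into_rtrancl[rotated])
        qed (rule UU)
      qed simp
    qed
    have "(u, v) \<in> ?A\<^sup>*" if "u \<in> U \<union> W" "v \<in> U \<union> W" for u v
      using that UU WW sym_adj_rtrancl by (meson UnE rtrancl_trans)
    then have "connected_graph (?K\<lparr>edges := Q i\<rparr>)"
      using z by (auto simp: connected_graph_def reach_def induced_def)
    from connected_has_spanning_tree[OF K Qs this] show ?thesis by metis
  qed
  then obtain T' where T': "\<And>i. i < m \<Longrightarrow> T' i \<subseteq> Q i \<and> spanning_tree ?K (T' i)" by metis
  have "T' i \<inter> T' j = {}" if "i < m" "j < m" "i \<noteq> j" for i j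
    using Qd[OF that] T'[OF that(1)] T'[OF that(2)] by blast
  with T' show ?thesis unfolding tree_connected_def by blast
qed

lemma tree_connected_singleton:
  assumes "multigraph G"
  shows "tree_connected m (induced G {v})"
proof -
  interpret multigraph G by fact
  have "\<not> is_cycle (induced G {v}\<lparr>edges := {}\<rparr>) vs es" for vs es
    by (auto simp: is_cycle_def)
  then have "spanning_tree (induced G {v}) {}"
    by (auto simp: spanning_tree_def is_tree_def connected_graph_def reach_def induced_def)
  then show ?thesis unfolding tree_connected_def by (intro exI[of _ "\<lambda>_. {}"]) auto
qed

text \<open>A tree has a vertex by definition; \<open>m > 0\<close> guarantees that there is a tree
  at all.\<close>

lemma tree_connected_nonempty:
  assumes "m > 0" "tree_connected m G"
  shows "verts G \<noteq> {}"
  using assms by (auto simp: tree_connected_def spanning_tree_def is_tree_def connected_graph_def)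

text \<open>The set \<open>{v}\<close> is tree-connected, so a maximal tree-connected set containing
  \<open>v\<close> exists; all its supersets contain \<open>v\<close> too, so it is maximal among
  all sets.\<close>

lemma tree_connected_components_cover:
  assumes "multigraph G" "v \<in> verts G"
  shows "\<exists>U \<in> tree_connected_components m G. v \<in> U"
proof -
  interpret multigraph G by fact
  let ?F = "{U. v \<in> U \<and> U \<subseteq> verts G \<and> tree_connected m (induced G U)}"
  have "finite ?F" using finite_verts by (auto intro: finite_subset[of _ "Pow (verts G)"])
  moreover have "{v} \<in> ?F" using assms tree_connected_singleton by auto
  ultimately obtain U where U: "U \<in> ?F" and max: "\<forall>W \<in> ?F. U \<subseteq> W \<longrightarrow> U = W"
    by (rule finite_has_maximal2[THEN bexE]) blast
  have "\<not> tree_connected m (induced G W)" if "U \<subset> W" "W \<subseteq> verts G" for W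
    using that U bspec[OF max, of W] by blast
  with U have "U \<in> tree_connected_components m G" "v \<in> U"
    unfolding tree_connected_components_def by blast+
  then show ?thesis by blast
qed

text \<open>The union of two intersecting components is again tree-connected, so by maximality both
  are equal to it.\<close>

lemma tree_connected_components_disjoint:
  assumes "multigraph G" "U \<in> tree_connected_components m G" "W \<in> tree_connected_components m G"
    "U \<inter> W \<noteq> {}"
  shows "U = W"
proof -
  have U: "U \<subseteq> verts G" "tree_connected m (induced G U)"
    and maxU: "\<And>X. U \<subset> X \<Longrightarrow> X \<subseteq> verts G \<Longrightarrow> \<not> tree_connected m (induced G X)"
    using assms(2) by (simp_all add: tree_connected_components_def)
  have W: "W \<subseteq> verts G" "tree_connected m (induced G W)"
    and maxW: "\<And>X. W \<subset> X \<Longrightarrow> X \<subseteq> verts G \<Longrightarrow> \<not> tree_connected m (induced G X)"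
    using assms(3) by (simp_all add: tree_connected_components_def)
  have "tree_connected m (induced G (U \<union> W))"
    using tree_connected_Un[OF assms(1) U(1) W(1) assms(4) U(2) W(2)] .
  then have "\<not> U \<subset> U \<union> W" "\<not> W \<subset> U \<union> W"
    using maxU[of "U \<union> W"] maxW[of "U \<union> W"] U(1) W(1) by blast+
  then show ?thesis by blast
qed

section \<open>Independent sets in graphs of bounded degree\<close>

definition edges_within :: "('v, 'e) mgraph \<Rightarrow> 'v set \<Rightarrow> 'e set" where
  "edges_within G U = {e \<in> edges G. ends G e \<subseteq> U}"

lemma (in multigraph) finite_edges_within [simp]: "finite (edges_within G U)"
  using finite_edges by (simp add: edges_within_def)

text \<open>Double counting of incidences: an edge has only two ends. The edges on the right are
  those lost when \<open>N\<close> is deleted from \<open>A\<close>.\<close>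

lemma (in multigraph) degree_sum_le:
  assumes "finite N"
  shows "(\<Sum>u\<in>N. card {e \<in> edges_within G A. u \<in> ends G e})
    \<le> 2 * card {e \<in> edges_within G A. ends G e \<inter> N \<noteq> {}}" (is "?L \<le> 2 * card ?D")
proof -
  have "?L = (\<Sum>u\<in>N. \<Sum>e\<in>?D. if u \<in> ends G e then 1 else 0)"
  proof (rule sum.cong)
    fix u assume "u \<in> N"
    then have "{e \<in> edges_within G A. u \<in> ends G e} = {e \<in> ?D. u \<in> ends G e}" by auto
    then show "card {e \<in> edges_within G A. u \<in> ends G e} = (\<Sum>e\<in>?D. if u \<in> ends G e then 1 else 0)"
      by (simp add: sum.If_cases Int_def)
  qed simp
  also have "\<dots> = (\<Sum>e\<in>?D. \<Sum>u\<in>N. if u \<in> ends G e then 1 else 0)" by (rule sum.swap)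
  also have "\<dots> \<le> (\<Sum>e\<in>?D. 2)"
  proof (rule sum_mono)
    fix e assume "e \<in> ?D"
    then have e: "card (ends G e) = 2" using ends_wf by (auto simp: edges_within_def)
    then have "finite (ends G e)" by (metis card.infinite zero_neq_numeral)
    then have "card {u \<in> N. u \<in> ends G e} \<le> 2"
      using card_mono[of "ends G e" "{u \<in> N. u \<in> ends G e}"] e by auto
    then show "(\<Sum>u\<in>N. if u \<in> ends G e then 1 else 0) \<le> (2::nat)"
      using assms by (simp add: sum.If_cases Int_def)
  qed
  finally show ?thesis by simp
qed

text \<open>Each edge at \<open>v\<close> contributes one further vertex; parallel edges contribute
  the same one, hence only an inequality.\<close>

lemma (in multigraph) card_closed_neighbourhood_le:
  "card (insert v (\<Union>(ends G ` {e \<in> edges_within G A. v \<in> ends G e})))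
     \<le> Suc (card {e \<in> edges_within G A. v \<in> ends G e})" (is "card ?N \<le> Suc (card ?E)")
proof -
  have "card (\<Union>e\<in>?E. ends G e - {v}) \<le> (\<Sum>e\<in>?E. card (ends G e - {v}))"
    by (rule card_UN_le) simp
  also have "\<dots> = (\<Sum>e\<in>?E. 1)"
  proof (rule sum.cong)
    fix e assume "e \<in> ?E"
    then have "card (ends G e) = 2" "v \<in> ends G e" using ends_wf by (auto simp: edges_within_def)
    then show "card (ends G e - {v}) = 1" by simp
  qed simp
  finally have "card (\<Union>e\<in>?E. ends G e - {v}) \<le> card ?E" by simp
  then have "card (insert v (\<Union>e\<in>?E. ends G e - {v})) \<le> Suc (card ?E)"
    by (intro card_insert_le_m1) simp_all
  moreover have "?N = insert v (\<Union>e\<in>?E. ends G e - {v})" by blast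
  ultimately show ?thesis by (simp only:)
qed

text \<open>Accounting for one greedy step: \<open>k\<close> is the size of the closed neighbourhood
  of a vertex of minimum degree \<open>d\<close>, and \<open>k * d\<close> bounds twice the number
  of deleted edges from below.\<close>

lemma greedy_step_bound:
  fixes k d m :: nat
  assumes "k \<le> Suc d" "d \<le> m"
  shows "2 * (m + 1) * k \<le> (m + 1) * (m + 2) + k * d"
proof -
  obtain t where m: "m = d + t" using assms(2) le_Suc_ex by blast
  have "k * (2 * (m + 1) - d) \<le> Suc d * (2 * (m + 1) - d)" using assms(1) by (rule mult_le_mono1)
  \<comment> \<open>With \<open>t = m - d\<close> the two sides differ by
    \<open>t * (t + 1)\<close>.\<close>
  also have "\<dots> \<le> (m + 1) * (m + 2)" by (simp add: m algebra_simps)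
  finally have "k * (2 * (m + 1) - d) + k * d \<le> (m + 1) * (m + 2) + k * d" by simp
  moreover have "k * (2 * (m + 1) - d) + k * d = k * (2 * (m + 1))"
    using assms(2) by (simp flip: distrib_left)
  ultimately show ?thesis by (simp add: mult.commute)
qed

text \<open>Greedy choice: put a vertex \<open>v\<close> of minimum degree into \<open>I\<close>,
  delete its closed neighbourhood \<open>N\<close> and recurse. All vertices of \<open>N\<close>
  have degree at least \<open>d\<close>, so many edges disappear with \<open>N\<close>. The bound is
  doubled to stay in the natural numbers.\<close>

lemma (in multigraph) independent_set_bounded_degree:
  assumes "finite A" "\<And>v. v \<in> A \<Longrightarrow> card {e \<in> edges_within G A. v \<in> ends G e} \<le> m"
  shows "\<exists>I \<subseteq> A. edges_within G I = {} \<and>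
    2 * (m + 1) * card A \<le> (m + 1) * (m + 2) * card I + 2 * card (edges_within G A)"
  using assms
proof (induction "card A" arbitrary: A rule: less_induct)
  case less
  show ?case
  proof (cases "A = {}")
    case True
    have "ends G e \<noteq> {}" if "e \<in> edges G" for e using ends_wf[OF that] by auto
    with True show ?thesis by (intro exI[of _ "{}"]) (auto simp: edges_within_def)
  next
    case False
    let ?E = "\<lambda>v. {e \<in> edges_within G A. v \<in> ends G e}"
    obtain v where v: "v \<in> A" and vmin: "\<And>u. u \<in> A \<Longrightarrow> card (?E v) \<le> card (?E u)"
      using False less.prems(1) arg_min_if_finite(1)[of A "\<lambda>v. card (?E v)"]
        arg_min_least[of A _ "\<lambda>v. card (?E v)"] by blast
    define d where "d = card (?E v)"
    define N where "N = insert v (\<Union>(ends G ` ?E v))"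
    define D where "D = {e \<in> edges_within G A. ends G e \<inter> N \<noteq> {}}"
    have NA: "N \<subseteq> A" using v by (auto simp: N_def edges_within_def)
    then have finN: "finite N" using less.prems(1) finite_subset by blast
    have kle: "card N \<le> Suc d" unfolding N_def d_def by (rule card_closed_neighbourhood_le)
    have dm: "d \<le> m" unfolding d_def using v by (rule less.prems(2))
    have "card N * d \<le> (\<Sum>u\<in>N. card (?E u))"
      using sum_mono[of N "\<lambda>_. d" "\<lambda>u. card (?E u)"] vmin NA by (auto simp: d_def)
    also have "\<dots> \<le> 2 * card D" unfolding D_def by (rule degree_sum_le[OF finN])
    finally have D: "card N * d \<le> 2 * card D" .
    have "edges_within G A = D \<union> edges_within G (A - N)" "D \<inter> edges_within G (A - N) = {}"
      using ends_wf by (auto simp: D_def edges_within_def)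
    then have eA: "card (edges_within G A) = card D + card (edges_within G (A - N))"
      by (metis card_Un_disjoint finite_Un finite_edges_within)
    have cA: "card A = card N + card (A - N)"
      using NA finN less.prems(1) by (simp add: card_Diff_subset card_mono)
    have "card N > 0" using finN by (auto simp: card_gt_0_iff N_def)
    then have "card (A - N) < card A" using cA by simp
    moreover have "card {e \<in> edges_within G (A - N). u \<in> ends G e} \<le> m" if "u \<in> A - N" for u
    proof -
      have "card {e \<in> edges_within G (A - N). u \<in> ends G e} \<le> card (?E u)"
        using finite_edges by (intro card_mono) (auto simp: edges_within_def)
      also have "\<dots> \<le> m" using that less.prems(2) by blast
      finally show ?thesis .
    qed
    ultimately obtain I where I: "I \<subseteq> A - N" "edges_within G I = {}"
      and Ic: "2 * (m + 1) * card (A - N)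
        \<le> (m + 1) * (m + 2) * card I + 2 * card (edges_within G (A - N))"
      using less.hyps[of "A - N"] less.prems(1) by auto
    have finI: "finite I" and vI: "v \<notin> I"
      using I(1) less.prems(1) by (auto simp: N_def intro: finite_subset)
    \<comment> \<open>An edge at \<open>v\<close> inside \<open>A\<close> has both ends in
      \<open>N\<close>, which \<open>I\<close> avoids; its only end would be
      \<open>v\<close>.\<close>
    have "edges_within G (insert v I) = {}"
    proof (rule ccontr)
      assume "edges_within G (insert v I) \<noteq> {}"
      then obtain e where e: "e \<in> edges G" "ends G e \<subseteq> insert v I"
        by (auto simp: edges_within_def)
      show False
      proof (cases "v \<in> ends G e")
        case True
        moreover have "ends G e \<subseteq> A" using e(2) I(1) v by blast
        ultimately have "e \<in> ?E v" using e(1) by (simp add: edges_within_def)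
        then have "ends G e \<subseteq> N" unfolding N_def by blast
        then have "ends G e \<subseteq> {v}" using e I(1) by auto
        then have "card (ends G e) \<le> 1" using card_mono[of "{v}"] by fastforce
        with ends_wf[OF e(1)] show False by simp
      next
        case False
        with e I(2) show False by (auto simp: edges_within_def)
      qed
    qed
    moreover have "insert v I \<subseteq> A" using v I(1) by auto
    moreover have "2 * (m + 1) * card A
        \<le> (m + 1) * (m + 2) * card (insert v I) + 2 * card (edges_within G A)"
    proof -
      have "2 * (m + 1) * card N \<le> (m + 1) * (m + 2) + card N * d"
        using kle dm by (rule greedy_step_bound)
      moreover have "2 * (m + 1) * card A = 2 * (m + 1) * card N + 2 * (m + 1) * card (A - N)"
        by (simp only: cA distrib_left)
      moreover have "(m + 1) * (m + 2) * card (insert v I)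
          = (m + 1) * (m + 2) + (m + 1) * (m + 2) * card I"
        using finI vI by simp
      ultimately show ?thesis using D Ic eA by linarith
    qed
    ultimately show ?thesis by blast
  qed
qed

section \<open>Deleting vertices from a labelled graph\<close>

text \<open>A partition of the vertices is encoded by a labelling whose fibres are its parts.\<close>

definition crossing :: "('v, 'e) mgraph \<Rightarrow> ('v \<Rightarrow> 'p) \<Rightarrow> 'v set \<Rightarrow> 'e set" where
  "crossing G p U = {e \<in> edges_within G U. inj_on p (ends G e)}"

text \<open>The label is constant along edges, hence on components, so evaluating it at a chosen
  vertex of each component reaches every label.\<close>

lemma num_components_ge:
  assumes "finite (verts G)" "\<And>u v. (u, v) \<in> adj G \<Longrightarrow> p u = p v"
  shows "card (p ` verts G) \<le> num_components G"
proof -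
  have const: "p u = p v" if "(u, v) \<in> (adj G)\<^sup>*" for u v
    using that by (induction rule: rtrancl_induct) (use assms(2) in auto)
  let ?Q = "verts G // reach G" and ?g = "\<lambda>C. p (SOME w. w \<in> C)"
  have Q: "?Q = (\<lambda>v. reach G `` {v}) ` verts G" by (auto simp: quotient_def)
  have "?g (reach G `` {v}) = p v" if "v \<in> verts G" for v
  proof -
    have "v \<in> reach G `` {v}" using that by (auto simp: reach_def)
    then have "(SOME w. w \<in> reach G `` {v}) \<in> reach G `` {v}" by (rule someI)
    then show ?thesis using const by (auto simp: reach_def)
  qed
  then have "p ` verts G \<subseteq> ?g ` ?Q" unfolding Q by (auto simp: image_image)
  moreover have "finite ?Q" unfolding Q using assms(1) by simp
  ultimately show ?thesis unfolding num_components_def by (meson surj_card_le)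
qed

text \<open>Induction on \<open>U\<close>, removing one vertex at a time until the parts of size at
  least two are cut off and the other vertices have degree at most \<open>m\<close>. Everything is
  doubled to avoid halves.\<close>

lemma (in multigraph) deletion_set_exists:
  assumes "U \<subseteq> verts G"
  shows "\<exists>X \<subseteq> U. 2 * m * card (p ` U) + 2 * card X
    \<le> 2 * m * num_components (induced G (U - X)) + m * (m + 1) * num_isolated (induced G (U - X))
      + 2 * card (crossing G p U)"
  using assms
proof (induction "card U" arbitrary: U rule: less_induct)
  case less
  have finU: "finite U" using less.prems finite_verts finite_subset by blast
  have fincr: "finite (crossing G p W)" for W by (simp add: crossing_def)
  let ?C = "\<lambda>v. {e \<in> crossing G p U. v \<in> ends G e}"
  \<comment> \<open>Moving \<open>v\<close> into \<open>X\<close> is affordable if the crossing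
    edges at \<open>v\<close> pay for \<open>m\<close> times the loss of labels and for the growth
    of \<open>X\<close> by 1.\<close>
  have remove: ?case
    if v: "v \<in> U" and le: "m * card (p ` U) + 1 \<le> m * card (p ` (U - {v})) + card (?C v)" for v
  proof -
    have "crossing G p U = crossing G p (U - {v}) \<union> ?C v" "crossing G p (U - {v}) \<inter> ?C v = {}"
      by (auto simp: crossing_def edges_within_def)
    then have cr: "card (crossing G p U) = card (crossing G p (U - {v})) + card (?C v)"
      using fincr[of U] fincr[of "U - {v}"] by (metis card_Un_disjoint finite_Un)
    have "card (U - {v}) < card U" using v finU by (meson card_Diff1_less)
    from less.hyps[OF this] less.prems obtain X where X: "X \<subseteq> U - {v}"
      and Xc: "2 * m * card (p ` (U - {v})) + 2 * card X
        \<le> 2 * m * num_components (induced G (U - {v} - X))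
          + m * (m + 1) * num_isolated (induced G (U - {v} - X))
          + 2 * card (crossing G p (U - {v}))"
      by blast
    have "U - insert v X = U - {v} - X" by auto
    moreover have "card (insert v X) = Suc (card X)"
      using X finU by (subst card_insert_disjoint) (auto intro: finite_subset)
    ultimately show ?thesis using Xc cr le X v by (intro exI[of _ "insert v X"]) auto
  qed
  \<comment> \<open>\<open>B\<close> collects the parts of size at least two in the current
    \<open>U\<close>, and \<open>A\<close> the singleton parts.\<close>
  define B where "B = {v \<in> U. \<exists>w \<in> U. w \<noteq> v \<and> p w = p v}"
  define A where "A = U - B"
  consider (shared) v where "v \<in> B" "?C v \<noteq> {}" | (large) v where "v \<in> U" "card (?C v) > m"
    | (rest) "\<And>v. v \<in> B \<Longrightarrow> ?C v = {}" "\<And>v. v \<in> U \<Longrightarrow> card (?C v) \<le> m"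
    by (meson not_le)
  then show ?case
  proof cases
    case shared
    then obtain w where "v \<in> U" "w \<in> U" "w \<noteq> v" "p w = p v" by (auto simp: B_def)
    then have "v \<in> U" "w \<in> U - {v}" "p v = p w" by simp_all
    then have "p x \<in> p ` (U - {v})" if "x \<in> U" for x using that by (cases "x = v") auto
    then have "p ` (U - {v}) = p ` U" by blast
    moreover have "v \<in> U" by fact
    moreover have "card (?C v) > 0" using shared fincr by (simp add: card_gt_0_iff)
    ultimately show ?thesis by (intro remove[of v]) auto
  next
    case large
    have "p ` U = insert (p v) (p ` (U - {v}))" using large by auto
    then have "card (p ` U) \<le> Suc (card (p ` (U - {v})))"
      using finU by (simp add: card_insert_if)
    then have "m * card (p ` U) \<le> m * Suc (card (p ` (U - {v})))" by (rule mult_le_mono2)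
    then have "m * card (p ` U) \<le> m * card (p ` (U - {v})) + m" by simp
    with large show ?thesis by (intro remove[of v]) auto
  next
    case rest
    have injA: "u = v" if "u \<in> A" "v \<in> U" "p u = p v" for u v
      using that by (auto simp: A_def B_def)
    \<comment> \<open>No crossing edge meets \<open>B\<close> any more, while within
      \<open>A\<close> distinct vertices have distinct labels.\<close>
    have cross_A: "crossing G p U = edges_within G A"
    proof (intro equalityI subsetI)
      fix e assume "e \<in> crossing G p U"
      with rest(1) show "e \<in> edges_within G A"
        by (auto simp: crossing_def edges_within_def A_def)
    next
      fix e assume "e \<in> edges_within G A"
      with injA show "e \<in> crossing G p U"
        by (auto simp: crossing_def edges_within_def A_def intro!: inj_onI)
    qed
    have "card {e \<in> edges_within G A. v \<in> ends G e} \<le> m" if "v \<in> A" for v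
      using rest(2)[of v] that by (simp add: cross_A A_def)
    moreover have finA: "finite A" using finU by (simp add: A_def)
    ultimately obtain I where I: "I \<subseteq> A" "edges_within G I = {}"
      and Ic: "2 * (m + 1) * card A \<le> (m + 1) * (m + 2) * card I + 2 * card (edges_within G A)"
      using independent_set_bounded_degree[of A m] by blast
    \<comment> \<open>The set to delete is \<open>A - I\<close>, which leaves \<open>B\<close> and
      the independent set \<open>I\<close>.\<close>
    let ?K = "induced G (U - (A - I))"
    have verts_K: "verts ?K = B \<union> I" using I(1) by (auto simp: induced_def A_def B_def)
    have finI: "finite I" using I(1) finA finite_subset by blast
    \<comment> \<open>A remaining edge with different labels would be a crossing edge, hence lie
      within \<open>A\<close> and thus within \<open>I\<close>.\<close>
    have same: "p u = p v" if e: "e \<in> edges ?K" "ends G e = {u, v}" for e u v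
    proof (rule ccontr)
      assume "p u \<noteq> p v"
      then have "e \<in> crossing G p U" using e
        by (auto simp: induced_def crossing_def edges_within_def)
      then have "e \<in> edges_within G I" using e(1) I(1) unfolding cross_A
        by (auto simp: induced_def edges_within_def)
      with I(2) show False by simp
    qed
    have "card (p ` verts ?K) \<le> num_components ?K"
    proof (rule num_components_ge)
      show "finite (verts ?K)" using finU by (simp add: induced_def)
      show "p u = p v" if uv: "(u, v) \<in> adj ?K" for u v
      proof -
        obtain e where "e \<in> edges ?K" "ends ?K e = {u, v}" using uv unfolding adj_def by blast
        then show ?thesis by (intro same[of e]) (simp_all add: induced_def)
      qed
    qed
    moreover have disj: "card (p ` (B \<union> J)) = card (p ` B) + card J" if "J \<subseteq> A" for J
    proof -
      have sub: "J \<inter> B = {}" "J \<subseteq> U" "B \<subseteq> U" using that by (auto simp: A_def B_def)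
      have "p a \<noteq> p b" if "a \<in> J" "b \<in> B" for a b
        using injA[of a b] that sub \<open>J \<subseteq> A\<close> by blast
      then have "p ` B \<inter> p ` J = {}" by fastforce
      moreover have "inj_on p J"
      proof (rule inj_onI)
        show "a = b" if "a \<in> J" "b \<in> J" "p a = p b" for a b
          using injA[of a b] that sub \<open>J \<subseteq> A\<close> by blast
      qed
      moreover have "finite B" "finite J" using finU that finA by (auto simp: B_def intro: finite_subset)
      ultimately show ?thesis by (simp add: image_Un card_Un_disjoint card_image)
    qed
    ultimately have comp: "card (p ` B) + card I \<le> num_components ?K"
      using I(1) by (simp add: verts_K)
    have iso: "card I \<le> num_isolated ?K"
      unfolding num_isolated_def
    proof (rule card_mono)
      show "finite {v \<in> verts ?K. \<forall>e \<in> edges ?K. v \<notin> ends ?K e}" using finU by (simp add: induced_def)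
      \<comment> \<open>Both ends of a remaining edge carry the same label, but a vertex of
        \<open>I\<close> shares its label with no other vertex of \<open>U\<close>.\<close>
      have "v \<notin> ends G e" if v: "v \<in> I" and e: "e \<in> edges ?K" for v e
      proof
        assume ve: "v \<in> ends G e"
        have eG: "e \<in> edges G" "ends G e \<subseteq> U" using e by (auto simp: induced_def)
        obtain x y where xy: "ends G e = {x, y}" "x \<noteq> y"
          using ends_wf[OF eG(1)] by (auto simp: card_2_iff)
        have "p x = p y" using same e xy(1) by blast
        with xy ve v I(1) injA[of x y] injA[of y x] eG(2) show False by auto
      qed
      then show "I \<subseteq> {v \<in> verts ?K. \<forall>e \<in> edges ?K. v \<notin> ends ?K e}"
        using verts_K by (auto simp: induced_def)
    qed
    have "U = B \<union> A" by (auto simp: A_def B_def)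
    then have pU: "card (p ` U) = card (p ` B) + card A" using disj[of A] by simp
    have cX: "card (A - I) + card I = card A"
      using I(1) finI finA by (simp add: card_Diff_subset card_mono)
    have "2 * m * card (p ` U) + 2 * card (A - I)
      \<le> 2 * m * num_components ?K + m * (m + 1) * num_isolated ?K + 2 * card (crossing G p U)"
    \<comment> \<open>Here \<open>card (p\<close> U)\<open>splits into\<close>card (p
      \<open>B)\<close> and \<open>card A\<close>, so \<open>A\<close> has total weight
      \<open>2 * (m + 1)\<close>. The coefficients of \<open>card I\<close> match because
      \<open>(m + 1) * (m + 2) - 2 = 2 * m + m * (m + 1)\<close>.\<close>
    proof -
      have "2 * m * (card (p ` B) + card I) \<le> 2 * m * num_components ?K"
        using comp by (rule mult_le_mono2)
      moreover have "m * (m + 1) * card I \<le> m * (m + 1) * num_isolated ?K"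
        using iso by (rule mult_le_mono2)
      ultimately show ?thesis using Ic cX unfolding pU cross_A
        by (simp add: algebra_simps)
    qed
    moreover have "A - I \<subseteq> U" by (auto simp: A_def)
    ultimately show ?thesis by blast
  qed
qed

section \<open>From the component partition to the bound on \<open>Omega\<close>\<close>

text \<open>Label each vertex by a component containing it. Every component occurs as a label, and
  an edge with differently labelled ends crosses the partition.\<close>

lemma Omega_le_labelling:
  assumes "m > 0" "multigraph G"
  shows "\<exists>p :: 'v \<Rightarrow> 'v set.
    Omega m (G :: ('v, 'e) mgraph) \<le> int m * int (card (p ` verts G)) - int (card (crossing G p (verts G)))"
proof -
  interpret multigraph G by fact
  define P where "P = tree_connected_components m G"
  obtain p where p: "\<And>v. v \<in> verts G \<Longrightarrow> p v \<in> P \<and> v \<in> p v"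
    using tree_connected_components_cover[OF assms(2), of _ m] unfolding P_def by metis
  have "P \<subseteq> p ` verts G"
  proof
    fix U assume U: "U \<in> P"
    then have "U \<noteq> {}" "U \<subseteq> verts G"
      using tree_connected_nonempty[OF assms(1), of "induced G U"]
      by (auto simp: P_def tree_connected_components_def induced_def)
    then obtain u where u: "u \<in> U" "u \<in> verts G" by blast
    \<comment> \<open>Both \<open>p u\<close> and \<open>U\<close> are components containing
      \<open>u\<close>, so disjointness forces them to agree.\<close>
    then have "p u = U"
      using tree_connected_components_disjoint[OF assms(2), of U m "p u"] U p[of u]
      unfolding P_def by blast
    with u show "U \<in> p ` verts G" by blast
  qed
  then have "card P \<le> card (p ` verts G)" using finite_verts by (simp add: card_mono)
  moreover have "card (crossing G p (verts G)) \<le> crossing_edges G P"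
    unfolding crossing_edges_def
  proof (rule card_mono)
    show "finite {e \<in> edges G. \<exists>u v. \<exists>X \<in> P. \<exists>Y \<in> P.
        ends G e = {u, v} \<and> u \<in> X \<and> v \<in> Y \<and> X \<noteq> Y}"
      using finite_edges by simp
    show "crossing G p (verts G) \<subseteq> {e \<in> edges G. \<exists>u v. \<exists>X \<in> P. \<exists>Y \<in> P.
        ends G e = {u, v} \<and> u \<in> X \<and> v \<in> Y \<and> X \<noteq> Y}"
    proof
      fix e assume e: "e \<in> crossing G p (verts G)"
      then have eG: "e \<in> edges G" by (simp add: crossing_def edges_within_def)
      then obtain u v where uv: "ends G e = {u, v}" "u \<noteq> v"
        using ends_wf by (metis card_2_iff)
      then have "p u \<noteq> p v" using e by (auto simp: crossing_def)
      moreover have "u \<in> verts G" "v \<in> verts G" using ends_wf[OF eG] uv by auto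
      ultimately show "e \<in> {e \<in> edges G. \<exists>u v. \<exists>X \<in> P. \<exists>Y \<in> P.
        ends G e = {u, v} \<and> u \<in> X \<and> v \<in> Y \<and> X \<noteq> Y}"
        using eG uv p by blast
    qed
  qed
  ultimately have "Omega m G \<le> int m * int (card (p ` verts G)) - int (card (crossing G p (verts G)))"
    unfolding Omega_def P_def[symmetric] Let_def
    by (intro diff_mono mult_left_mono) auto
  then show ?thesis by blast
qed

theorem theorem6p3:
  fixes m :: nat and G :: "('v, 'e) mgraph" and \<epsilon> c :: real
  assumes "m > 0"
    and "multigraph G"
    and "0 \<le> \<epsilon>" and "\<epsilon> \<le> 1" and "1 \<le> c"
    and "\<forall>S \<subseteq> verts G.
           real (num_components (del_verts G S))
             + (real m + 1) / 2 * real (num_isolated (del_verts G S))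
           \<le> \<epsilon> / real m * real (card S) + c"
  shows "\<forall>S \<subseteq> verts G. real_of_int (Omega m (del_verts G S)) \<le> \<epsilon> * real (card S) + c * real m"
proof (intro allI impI)
  fix S assume S: "S \<subseteq> verts G"
  define H where "H = del_verts G S"
  have H: "multigraph H" unfolding H_def del_verts_def using assms(2) by (simp add: multigraph_induced)
  have VH: "verts H = verts G - S" by (simp add: H_def del_verts_def induced_def)
  obtain p :: "'v \<Rightarrow> 'v set" where p: "Omega m H
      \<le> int m * int (card (p ` verts H)) - int (card (crossing H p (verts H)))"
    using Omega_le_labelling[OF assms(1) H] by blast
  obtain X where X: "X \<subseteq> verts H" and Xc: "2 * m * card (p ` verts H) + 2 * card X
    \<le> 2 * m * num_components (induced H (verts H - X))
      + m * (m + 1) * num_isolated (induced H (verts H - X)) + 2 * card (crossing H p (verts H))"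
    using multigraph.deletion_set_exists[OF H order.refl] by blast
  \<comment> \<open>Deleting \<open>X\<close> from \<open>H\<close> is deleting
    \<open>S \<union> X\<close> from \<open>G\<close>, so the hypothesis applies to this
    set.\<close>
  define K where "K = del_verts G (S \<union> X)"
  have "verts H - X = verts G - (S \<union> X)" by (auto simp: VH)
  then have K: "induced H (verts H - X) = K"
    unfolding K_def H_def del_verts_def by (simp add: induced_induced Diff_mono)
  have "finite (verts G)" using assms(2) by (rule multigraph.finite_verts)
  then have card_SX: "card (S \<union> X) = card S + card X"
    using S X by (intro card_Un_disjoint) (auto simp: VH intro: finite_subset)
  have hyp: "real m * (real (num_components K) + (real m + 1) / 2 * real (num_isolated K))
      \<le> real m * (\<epsilon> / real m * real (card (S \<union> X)) + c)"
    unfolding K_def using assms(6)[rule_format, of "S \<union> X"] S X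
    by (intro mult_left_mono) (auto simp: VH)
  have "real_of_int (Omega m H)
      \<le> real m * real (card (p ` verts H)) - real (card (crossing H p (verts H)))"
    using p by (metis (mono_tags) of_int_diff of_int_le_iff of_int_mult of_int_of_nat_eq)
  moreover have "2 * real m * real (card (p ` verts H)) + 2 * real (card X)
    \<le> 2 * real m * real (num_components K) + real m * (real m + 1) * real (num_isolated K)
      + 2 * real (card (crossing H p (verts H)))"
    using Xc[unfolded K, THEN of_nat_mono[where 'a = real]] by (simp add: algebra_simps)
  moreover have "real m * real (num_components K) + real m * (real m + 1) / 2 * real (num_isolated K)
      \<le> \<epsilon> * real (card S) + \<epsilon> * real (card X) + c * real m"
  proof -
    have "real m * (\<epsilon> / real m * real (card (S \<union> X)) + c) = \<epsilon> * real (card (S \<union> X)) + c * real m"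
      using assms(1) by (simp add: distrib_left)
    with hyp show ?thesis by (simp add: card_SX algebra_simps)
  qed
  \<comment> \<open>The term \<open>card X\<close> gained by the deletion absorbs the extra cost of
    \<open>X\<close> in the hypothesis; this is where \<open>\<epsilon> \<le> 1\<close>
    enters.\<close>
  moreover have "\<epsilon> * real (card X) \<le> real (card X)"
    using assms(4) by (simp add: mult_left_le_one_le assms(3))
  ultimately show "real_of_int (Omega m (del_verts G S)) \<le> \<epsilon> * real (card S) + c * real m"
    by (simp add: H_def[symmetric] field_simps)
qed

end
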